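(* Let $k,p\in\mathbb N$ and let $(\mathcal A,\mathcal B,\mathcal C,L)$ be an $\mathbb R^k$-valued state space model of dimension $kp$ with transfer function $H(z)=\mathcal C(zI_{kp}-\mathcal A)^{-1}\mathcal B$. Suppose there exists a coprime right polynomial fraction description $$H(z)=Q(z)P(z)^{-1},\qquad z\in\mathbb C\setminus\sigma(\mathcal A),$$ where $$P(z)=I_kz^p+A_1z^{p-1}+\dots+A_p,\qquad Q(z)=C_0+C_1z+\dots+C_qz^q,$$ with $A_1,\dots,A_p,C_0,\dots,C_q\in M_k(\mathbb R)$ and $q\in\mathbb N_0$, $p>q$. Then $P(z)$ and $Q(z)$ are unique (i.e. any two coprime right polynomial fraction descriptions of $H$ with polynomials of this form coincide). Moreover, defining $$\mathbf A=\begin{pmatrix} 0_k & I_k & 0_k & \cdots & 0_k \\ 0_k & 0_k & I_k & \ddots & \vdots \\ \vdots & & \ddots & \ddots & 0_k \\ 0_k & \cdots & \cdots & 0_k & I_k \\ -A_p & -A_{p-1} & \cdots & \cdots & -A_1 \end{pmatrix}\in M_{kp}(\mathbb R),\quad \mathbf B=\begin{pmatrix} 0_k \\ \vdots \\ 0_k \\ I_k \end{pmatrix}\in M_{kp\times k}(\mathbb R),$$ $$\mathbf C=(C_0,C_1,\dots,C_q,0_k,\dots,0_k)\in M_{k\times kp}(\mathbb R),$$ one has $\sigma(\mathcal A)=\sigma(\mathbf A)$ and $$H(z)=\mathbf C(zI_{kp}-\mathbf A)^{-1}\mathbf B,\qquad z\in\mathbb C\setminus\sigma(\mathbf A).$$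 Finally, a process $Y$ is a solution of the state space model $(\mathcal A,\mathcal B,\mathcal C,L)$ if and only if it is a solution of the state space model $(\mathbf A,\mathbf B,\mathbf C,L)$.
   Context: $M_k(\mathbb R)$ and $M_{k\times d}(\mathbb R)$ denote real $k\times k$ and $k\times d$ matrices, $0_k$ is the $k\times k$ zero matrix, and $\sigma(\cdot)$ is the set of eigenvalues. A state space model $(\mathcal A,\mathcal B,\mathcal C,L)$ of dimension $kp$ consists of an $\mathbb R^k$-valued Lévy process $L=(L(t))_{t\in\mathbb R}$ (stationary independent increments, continuous in probability, $L(0)=0$ a.s.) and real matrices $\mathcal A\in\mathbb R^{kp\times kp}$, $\mathcal B\in\mathbb R^{kp\times k}$, $\mathcal C\in\mathbb R^{k\times kp}$. A process $Y=(Y(t))_{t\in\mathbb R}$ is a solution of the model if there is an $\mathbb R^{kp}$-valued process $X$ with $dX(t)=\mathcal AX(t)dt+\mathcal B\,dL(t)$, i.e. $X(t)=e^{\mathcal A(t-s)}X(s)+\int_s^te^{\mathcal A(t-u)}\mathcal B\,dL(u)$ for $s<t$, and $Y(t)=\mathcal CX(t)$. A right polynomial fraction description $H(z)=Q(z)P(z)^{-1}$ with $k\times k$ matrix polynomials $P,Q$ is coprime if the stacked $2k\times k$ matrix $\begin{pmatrix} P(z) \\ Q(z) \end{pmatrix}$ has full rank $k$ for every $z\in\mathbb C$. *)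

theory Defs
  imports "HOL-Probability.Probability"
begin

section \<open>Matrices\<close>

abbreviation complex_matrix :: "real^'n^'m \<Rightarrow> complex^'n^'m" where
  "complex_matrix \<equiv> map_matrix complex_of_real"

definition spectrum :: "real^'n^'n \<Rightarrow> complex set" where
  "spectrum A = {z. \<exists>v. v \<noteq> 0 \<and> complex_matrix A *v v = z *s v}"

definition matrix_exp :: "real^'n^'n \<Rightarrow> real^'n^'n" where
  "matrix_exp A = (\<Sum>n. (1 / fact n) *\<^sub>R (((**) A ^^ n) (mat 1)))"

text \<open>\<^term>\<open>mat z\<close> is \<^term>\<open>z\<close> times the identity. The inverse below exists exactly when
  \<^term>\<open>z \<notin> spectrum A\<close>; only such \<^term>\<open>z\<close> are ever used.\<close>

definition transfer_function ::
    "real^'n^'n \<Rightarrow> real^'k^'n \<Rightarrow> real^'n^'m \<Rightarrow> complex \<Rightarrow> complex^'k^'m" where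
  "transfer_function A B C z =
     complex_matrix C ** matrix_inv (mat z - complex_matrix A) ** complex_matrix B"


section \<open>Right polynomial fraction descriptions\<close>

definition vstack :: "'a^'n^'l \<Rightarrow> 'a^'n^'m \<Rightarrow> 'a^'n^('l + 'm)" where
  "vstack P Q = (\<chi> i. case i of Inl a \<Rightarrow> P $ a | Inr b \<Rightarrow> Q $ b)"

definition right_coprime ::
    "(complex \<Rightarrow> complex^'k^'k) \<Rightarrow> (complex \<Rightarrow> complex^'k^'k) \<Rightarrow> bool" where
  "right_coprime P Q \<longleftrightarrow> (\<forall>z. rank (vstack (P z) (Q z)) = CARD('k))"

definition coprime_rpfd_on ::
    "complex set \<Rightarrow> (complex \<Rightarrow> complex^'k^'k) \<Rightarrow>
     (complex \<Rightarrow> complex^'k^'k) \<Rightarrow> (complex \<Rightarrow> complex^'k^'k) \<Rightarrow> bool" where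
  "coprime_rpfd_on D H P Q \<longleftrightarrow>
     right_coprime P Q \<and> (\<forall>z\<in>D. invertible (P z) \<and> H z = Q z ** matrix_inv (P z))"

text \<open>\<open>monic_matpoly p A\<close> is \<open>z \<mapsto> I z^p + A 1 z^(p-1) + \<dots> + A p\<close>; the values of \<open>A\<close> outside
  \<open>{1..p}\<close> are irrelevant. Likewise \<open>matpoly q C\<close> is \<open>z \<mapsto> C 0 + C 1 z + \<dots> + C q z^q\<close>.\<close>

definition monic_matpoly :: "nat \<Rightarrow> (nat \<Rightarrow> real^'k^'k) \<Rightarrow> complex \<Rightarrow> complex^'k^'k" where
  "monic_matpoly p A z = mat (z ^ p) + (\<Sum>i = 1..p. mat (z ^ (p - i)) ** complex_matrix (A i))"

definition matpoly :: "nat \<Rightarrow> (nat \<Rightarrow> real^'k^'k) \<Rightarrow> complex \<Rightarrow> complex^'k^'k" where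
  "matpoly q C z = (\<Sum>i\<le>q. mat (z ^ i) ** complex_matrix (C i))"


section \<open>The block companion realization\<close>

text \<open>Vectors of dimension \<open>kp\<close> are indexed by \<^typ>\<open>'p \<times> 'k\<close>, where \<^typ>\<open>'p\<close> is a finite linearly
  ordered type with \<open>p\<close> elements: the first component selects the block, the second one the position
  inside it. Blocks are numbered \<open>0, \<dots>, p - 1\<close> along the order of \<^typ>\<open>'p\<close>.\<close>

definition block_number :: "'p::{finite,linorder} \<Rightarrow> nat" where
  "block_number i = card {..<i}"

definition companion_A ::
    "(nat \<Rightarrow> real^'k^'k) \<Rightarrow> real^('p::{finite,linorder} \<times> 'k)^('p \<times> 'k)" where
  "companion_A A = (\<chi> r c.
     let i = block_number (fst r); j = block_number (fst c) in
     (if i = CARD('p) - 1 then - A (CARD('p) - j)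
      else if j = i + 1 then mat 1
      else 0) $ snd r $ snd c)"

definition companion_B :: "real^'k^('p::{finite,linorder} \<times> 'k)" where
  "companion_B = (\<chi> r c.
     (if block_number (fst r) = CARD('p) - 1 then mat 1 else 0) $ snd r $ c)"

definition companion_C ::
    "nat \<Rightarrow> (nat \<Rightarrow> real^'k^'k) \<Rightarrow> real^('p::{finite,linorder} \<times> 'k)^'k" where
  "companion_C q C = (\<chi> r c.
     let j = block_number (fst c) in (if j \<le> q then C j else 0) $ r $ snd c)"


section \<open>Levy-driven state space models\<close>

definition levy_process :: "'w measure \<Rightarrow> (real \<Rightarrow> 'w \<Rightarrow> real^'k) \<Rightarrow> bool" where
  "levy_process M L \<longleftrightarrow>
     prob_space M \<and>
     (\<forall>t. L t \<in> borel_measurable M) \<and>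
     (AE \<omega> in M. L 0 \<omega> = 0) \<and>
     (\<forall>n \<tau>. strict_mono_on {..n} \<tau> \<longrightarrow>
        prob_space.indep_vars M (\<lambda>_. borel)
          (\<lambda>i \<omega>. L (\<tau> (Suc i)) \<omega> - L (\<tau> i) \<omega>) {..<n::nat}) \<and>
     (\<forall>s t h. s < t \<longrightarrow>
        distr M borel (\<lambda>\<omega>. L (t + h) \<omega> - L (s + h) \<omega>) =
        distr M borel (\<lambda>\<omega>. L t \<omega> - L s \<omega>)) \<and>
     (\<forall>t. \<forall>\<epsilon>>0. ((\<lambda>s. measure M {\<omega> \<in> space M. \<epsilon> < norm (L s \<omega> - L t \<omega>)}) \<longlongrightarrow> 0) (at t))"

text \<open>\<open>has_levy_integral M L f s t J\<close> says that \<open>J\<close> is (a version of) the integral over \<open>[s, t]\<close> of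
  the deterministic matrix-valued function \<open>f\<close> with respect to \<open>L\<close>, i.e. that the Riemann sums
  \<open>\<Sum> f(x) (L(b) - L(a))\<close> over tagged partitions of \<open>[s, t]\<close> into intervals \<open>[a, b]\<close> with tags \<open>x\<close>
  converge to \<open>J\<close> in probability as the mesh tends to 0. For continuous \<open>f\<close>, the only case used
  below, this limit exists and is the usual stochastic integral.\<close>

definition has_levy_integral ::
    "'w measure \<Rightarrow> (real \<Rightarrow> 'w \<Rightarrow> real^'k) \<Rightarrow> (real \<Rightarrow> real^'k^'n) \<Rightarrow> real \<Rightarrow> real \<Rightarrow>
     ('w \<Rightarrow> real^'n) \<Rightarrow> bool" where
  "has_levy_integral M L f s t J \<longleftrightarrow>
     J \<in> borel_measurable M \<and>
     (\<forall>\<epsilon>>0. \<exists>\<delta>>0. \<forall>D. D tagged_division_of {s..t} \<and> (\<lambda>x. ball x \<delta>) fine D \<longrightarrow>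
        measure M {\<omega> \<in> space M.
          \<epsilon> < norm ((\<Sum>(x, K)\<in>D. f x *v (L (Sup K) \<omega> - L (Inf K) \<omega>)) - J \<omega>)} < \<epsilon>)"

text \<open>Stochastic integrals are only determined up to null sets; accordingly, both the state equation
  (for each \<open>s < t\<close>) and the observation equation (for each \<open>t\<close>) hold almost surely.\<close>

definition state_process ::
    "'w measure \<Rightarrow> (real \<Rightarrow> 'w \<Rightarrow> real^'k) \<Rightarrow> real^'n^'n \<Rightarrow> real^'k^'n \<Rightarrow>
     (real \<Rightarrow> 'w \<Rightarrow> real^'n) \<Rightarrow> bool" where
  "state_process M L A B X \<longleftrightarrow>
     (\<forall>t. X t \<in> borel_measurable M) \<and>
     (\<forall>s t. s < t \<longrightarrow>
        (\<exists>J. has_levy_integral M L (\<lambda>u. matrix_exp ((t - u) *\<^sub>R A) ** B) s t J \<and>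
             (AE \<omega> in M. X t \<omega> = matrix_exp ((t - s) *\<^sub>R A) *v X s \<omega> + J \<omega>)))"

definition ssm_solution ::
    "'w measure \<Rightarrow> real^'n^'n \<Rightarrow> real^'k^'n \<Rightarrow> real^'n^'m \<Rightarrow> (real \<Rightarrow> 'w \<Rightarrow> real^'k) \<Rightarrow>
     (real \<Rightarrow> 'w \<Rightarrow> real^'m) \<Rightarrow> bool" where
  "ssm_solution M A B C L Y \<longleftrightarrow>
     (\<forall>t. Y t \<in> borel_measurable M) \<and>
     (\<exists>X. state_process M L A B X \<and> (\<forall>t. AE \<omega> in M. Y t \<omega> = C *v X t \<omega>))"

end

theory Submission
  imports Defs "HOL-Computational_Algebra.Fundamental_Theorem_Algebra"
begin

text \<open>
  Both models have the transfer function \<open>Q P\<^sup>-\<^sup>1\<close> near infinity, so their Markov parameters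
  \<open>C A\<^sup>n B\<close> agree. The companion model is controllable by its block structure, and it is observable
  because an unobservable eigenvector has the form \<open>(w, z w, z\<^sup>2 w, \<dots>)\<close> with \<open>P(z) w = Q(z) w = 0\<close>, which
  coprimality excludes. The pairs generated by the two input-to-state maps therefore form the graph
  of a linear map; as both state spaces have dimension \<open>kp\<close>, this map is an isomorphism \<open>S\<close> between
  the two models, and it carries spectra, transfer functions and solutions over. Applied to two
  companion models, \<open>S\<close> commutes with the block shift and fixes the input matrix, so \<open>S\<close> is the
  identity and the two fraction descriptions coincide.
\<close>

subsection \<open>Eigenvectors in invariant subspaces\<close>

lemma funpow_matrix_vector_linear:
  fixes A :: "'a::field^'n^'n"
  shows "Vector_Spaces.linear (*s) (*s) ((*v) A ^^ n)"
proof (induction n)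
  case 0
  show ?case using vec.linear_id by (simp add: id_def)
next
  case (Suc n)
  show ?case
    using Vector_Spaces.linear_compose[OF Suc matrix_vector_mul_linear_gen[of A]] by (simp add: o_def)
qed

text \<open>This is the vector p(A) v, built from iterates of \<open>v\<close> so that no matrix
  powers have to be formed.\<close>

definition poly_apply :: "'a::field poly \<Rightarrow> 'a^'n^'n \<Rightarrow> 'a^'n \<Rightarrow> 'a^'n" where
  "poly_apply p A v = (\<Sum>i\<le>degree p. coeff p i *s ((*v) A ^^ i) v)"

lemma poly_apply_altdef:
  assumes "degree p \<le> n"
  shows "poly_apply p A v = (\<Sum>i\<le>n. coeff p i *s ((*v) A ^^ i) v)"
  unfolding poly_apply_def
  by (rule sum.mono_neutral_left) (use assms in \<open>auto simp: coeff_eq_0\<close>)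

text \<open>Multiplying by X - z acts as A - z on the resulting vector. When the product annihilates
  \<open>v\<close>, the cofactor thus yields a solution of the eigenvector equation.\<close>

lemma poly_apply_linear_factor:
  "poly_apply ([:- z, 1:] * p) A v = A *v poly_apply p A v - z *s poly_apply p A v"
proof -
  let ?n = "degree p"
  \<comment> \<open>The sums run one past \<open>degree p\<close>, so that the shifted polynomial
    \<open>pCons 0 p\<close> and \<open>p\<close> itself share an index range.\<close>
  have "poly_apply ([:- z, 1:] * p) A v
      = (\<Sum>i\<le>Suc ?n. coeff ([:- z, 1:] * p) i *s ((*v) A ^^ i) v)"
    by (rule poly_apply_altdef, rule order.trans[OF degree_mult_le]) simp
  also have "\<dots> = (\<Sum>i\<le>Suc ?n. coeff (pCons 0 p) i *s ((*v) A ^^ i) v)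
      - (\<Sum>i\<le>Suc ?n. (z * coeff p i) *s ((*v) A ^^ i) v)"
    by (simp only: mult_pCons_left) (simp add: vector_sub_rdistrib flip: sum_subtractf)
  also have "(\<Sum>i\<le>Suc ?n. coeff (pCons 0 p) i *s ((*v) A ^^ i) v) = A *v poly_apply p A v"
    unfolding poly_apply_def
    by (subst sum.atMost_Suc_shift) (simp add: vec.linear_sum vector_scalar_commute matrix_vector_mult_basis vec.sum)
  also have "(\<Sum>i\<le>Suc ?n. (z * coeff p i) *s ((*v) A ^^ i) v) = z *s poly_apply p A v"
    by (subst poly_apply_altdef[of _ "Suc ?n"])
       (simp_all only: le_Suc_eq order_refl sum_cmul flip: vector_smult_assoc, simp)
  finally show ?thesis .
qed

text \<open>The n + 1 vectors v, A v, ..., A^n v of an n-dimensional space are linearly dependent,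
  and a dependence relation is an annihilating polynomial.\<close>

lemma poly_apply_annihilator:
  fixes A :: "'a::field^'n^'n"
  obtains p where "p \<noteq> 0" and "poly_apply p A v = 0"
\<comment> \<open>Dependence is a property of sets and does not see repetitions. If two iterates i
  and j coincide, X^i - X^j annihilates \<open>v\<close> directly.\<close>
proof (cases "inj_on (\<lambda>i. ((*v) A ^^ i) v) {..CARD('n)}")
  case True
  let ?f = "\<lambda>i. ((*v) A ^^ i) v"
  have "vec.dependent (?f ` {..CARD('n)})"
  proof (rule vec.dependent_biggerset_general)
    show "vec.dim (?f ` {..CARD('n)}) < card (?f ` {..CARD('n)})"
      using True vec.dim_subset_UNIV[of "?f ` {..CARD('n)}"]
      by (simp add: card_image vec.dimension_def card_cart_basis)
  qed
  then obtain u where u: "\<exists>v \<in> ?f ` {..CARD('n)}. u v \<noteq> 0"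
    and s: "(\<Sum>v\<in>?f ` {..CARD('n)}. u v *s v) = 0"
    by (subst (asm) vec.dependent_finite) auto
  define p where "p = (\<Sum>i\<le>CARD('n). monom (u (?f i)) i)"
  have c: "coeff p i = (if i \<le> CARD('n) then u (?f i) else 0)" for i
    by (simp add: p_def coeff_sum)
  have "p \<noteq> 0"
  proof
    assume "p = 0"
    then have "u (?f i) = 0" if "i \<le> CARD('n)" for i
      using c[of i] that by simp
    then show False using u by auto
  qed
  moreover have "poly_apply p A v = 0"
  proof -
    have "degree p \<le> CARD('n)" by (rule degree_le) (simp add: c)
    then show ?thesis
      using s True by (simp add: poly_apply_altdef c sum.reindex)
  qed
  ultimately show ?thesis by (rule that)
next
  case False
  then obtain i j where "i \<noteq> j" and e: "((*v) A ^^ i) v = ((*v) A ^^ j) v"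
    by (auto simp: inj_on_def)
  define p :: "'a poly" where "p = monom 1 i - monom 1 j"
  have "coeff p i \<noteq> 0" using \<open>i \<noteq> j\<close> by (simp add: p_def)
  then have "p \<noteq> 0" by auto
  moreover have "poly_apply p A v = 0"
  proof -
    have "degree p \<le> i + j" by (rule degree_le) (simp add: p_def)
    then have "poly_apply p A v = (\<Sum>l\<le>i+j. (if l = i then ((*v) A ^^ i) v else 0) -
        (if l = j then ((*v) A ^^ j) v else 0))"
      by (subst poly_apply_altdef) (auto simp: p_def \<open>i \<noteq> j\<close> intro!: sum.cong)
    then show ?thesis by (simp add: e sum_subtractf)
  qed
  ultimately show ?thesis by (rule that)
qed

text \<open>Take an annihilator p of \<open>v\<close> of least degree and a complex root z, and
  write p = (X - z) g. Minimality gives g(A) v nonzero, so it is an eigenvector; it lies in V by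
  invariance.\<close>

lemma eigenvector_in_invariant_subspace:
  fixes A :: "complex^'n^'n"
  assumes V: "vec.subspace V" and inv: "\<And>v. v \<in> V \<Longrightarrow> A *v v \<in> V" and v: "v \<in> V" "v \<noteq> 0"
  obtains z w where "w \<in> V" "w \<noteq> 0" "A *v w = z *s w"
proof -
  define p where "p = arg_min degree (\<lambda>p. p \<noteq> 0 \<and> poly_apply p A v = 0)"
  have "\<exists>p. p \<noteq> 0 \<and> poly_apply p A v = 0"
    using poly_apply_annihilator by metis
  then have p: "p \<noteq> 0" "poly_apply p A v = 0"
    and min: "\<And>g. g \<noteq> 0 \<Longrightarrow> poly_apply g A v = 0 \<Longrightarrow> degree p \<le> degree g"
    unfolding p_def by (metis (mono_tags, lifting) arg_min_natI arg_min_nat_le)+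
  have "degree p \<noteq> 0"
  proof
    assume "degree p = 0"
    then have "coeff p 0 *s v = 0" using p by (simp add: poly_apply_def)
    with \<open>degree p = 0\<close> p(1) v show False
      by (metis leading_coeff_0_iff vector_mul_eq_0)
  qed
  then obtain z where "poly p z = 0"
    using fundamental_theorem_of_algebra[of p] by (auto simp: constant_degree)
  then obtain g where g: "p = [:- z, 1:] * g"
    by (auto simp: poly_eq_0_iff_dvd)
  with p have "g \<noteq> 0" by auto
  then have deg: "degree g < degree p"
    using g by (simp add: degree_mult_eq del: mult_pCons_left)
  let ?w = "poly_apply g A v"
  have iter: "((*v) A ^^ i) v \<in> V" for i
    by (induction i) (auto simp: v inv)
  have "?w \<in> V"
    unfolding poly_apply_def by (intro vec.subspace_sum vec.subspace_scale V iter)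
  moreover have "?w \<noteq> 0"
    using min[OF \<open>g \<noteq> 0\<close>] deg by auto
  moreover have "A *v ?w = z *s ?w"
    using p(2) unfolding g poly_apply_linear_factor by simp
  ultimately show ?thesis by (rule that)
qed

subsection \<open>Complexification and coprimality\<close>

abbreviation complex_vector :: "real^'n \<Rightarrow> complex^'n" where
  "complex_vector v \<equiv> (\<chi> i. complex_of_real (v $ i))"

lemma complex_matrix_mult: "complex_matrix (A ** B) = complex_matrix A ** complex_matrix B"
  by (simp add: vec_eq_iff matrix_matrix_mult_def)

lemma complex_matrix_mult_vector:
  "complex_matrix A *v complex_vector v = complex_vector (A *v v)"
  by (simp add: vec_eq_iff matrix_vector_mult_def)

lemma complex_matrix_mat_1 [simp]: "complex_matrix (mat 1) = mat 1"
  by (simp add: vec_eq_iff mat_def)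

lemma complex_vector_eq_iff [simp]: "complex_vector v = complex_vector w \<longleftrightarrow> v = w"
  by (simp add: vec_eq_iff)

lemma complex_vector_eq_0_iff [simp]: "complex_vector v = 0 \<longleftrightarrow> v = 0"
  by (simp add: vec_eq_iff)

lemma complex_matrix_funpow_vector:
  fixes A :: "real^'n^'n"
  shows "((*v) (complex_matrix A) ^^ n) (complex_vector v) = complex_vector (((*v) A ^^ n) v)"
  by (induction n) (simp_all add: complex_matrix_mult_vector)

lemma mat_mult_vector: "mat z *v v = z *s (v :: 'a::semiring_1^'n)"
  by (simp add: vec_eq_iff matrix_vector_mult_def mat_def if_distrib[where f = "\<lambda>x. x * _"] cong: if_cong)

lemma matrix_inv_mult:
  fixes A :: "'a::semiring_1^'n^'n"
  assumes "invertible A"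
  shows "A ** matrix_inv A = mat 1" and "matrix_inv A ** A = mat 1"
  using someI_ex[OF assms[unfolded invertible_def]] unfolding matrix_inv_def by auto

lemma not_in_spectrum_iff: "z \<notin> spectrum A \<longleftrightarrow> invertible (mat z - complex_matrix A)"
  by (auto simp: spectrum_def invertible_left_inverse matrix_left_invertible_ker
      matrix_vector_mult_diff_rdistrib mat_mult_vector)

text \<open>Rank is computed from the rows: if they span the whole space, the matrix has a left
  inverse.\<close>

lemma full_rank_imp_ker_trivial:
  fixes A :: "'a::field^'n^'m"
  assumes "rank A = CARD('n)" and "A *v x = 0"
  shows "x = 0"
proof -
  have "vec.span (rows A) = UNIV"
    using assms(1) vec.dim_eq_full[of "rows A"]
    by (simp add: row_rank_def_gen vec.dimension_def card_cart_basis)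
  then show ?thesis
    using assms(2) matrix_left_invertible_ker[of A] matrix_left_invertible_span_rows_gen[of A] by blast
qed

text \<open>This is the form in which coprimality is used: P(z) and Q(z) have no common nonzero
  kernel vector.\<close>

lemma right_coprime_ker_trivial:
  assumes "right_coprime P Q" and "P z *v w = 0" and "Q z *v w = 0"
  shows "w = 0"
proof -
  have "(vstack (P z) (Q z) *v w) $ i = 0" for i
    using assms(2,3)
    by (cases i) (auto simp: vstack_def vec_eq_iff matrix_vector_mult_def)
  then have "vstack (P z) (Q z) *v w = 0" by (simp add: vec_eq_iff)
  with assms(1) show ?thesis
    by (metis right_coprime_def full_rank_imp_ker_trivial)
qed

subsection \<open>Resolvents and Markov parameters\<close>

lemma norm_vector_scalar_mult: "norm (z *s (v :: complex^'n)) = norm z * norm v"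
proof -
  have "norm (z *s v) = L2_set (\<lambda>i. norm z * norm (v $ i)) UNIV"
    by (simp add: norm_vec_def norm_mult)
  then show ?thesis
    by (simp add: norm_vec_def L2_set_right_distrib)
qed

text \<open>With K bounding the operator A, the reverse triangle inequality gives |(z - A) x| >=
  (|z| - K) |x|, hence both invertibility and the bound on the inverse.\<close>

lemma resolvent_bound:
  fixes A :: "complex^'n^'n"
  obtains K where "K > 0"
    and "\<And>z::complex. norm z > K \<Longrightarrow> invertible (mat z - A)"
    and "\<And>(z::complex) v. norm z > K \<Longrightarrow> norm (matrix_inv (mat z - A) *v v) \<le> norm v / (norm z - K)"
proof -
  have "bounded_linear ((*v) A)" by simp
  then obtain K where K: "K > 0" "\<And>x. norm (A *v x) \<le> norm x * K"
    using bounded_linear.pos_bounded by blast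
  have low: "norm x * (norm z - K) \<le> norm ((mat z - A) *v x)" for x z
  proof -
    have "norm (z *s x) - norm (A *v x) \<le> norm (z *s x - A *v x)"
      by (rule norm_triangle_ineq2)
    with K(2)[of x] show ?thesis
      by (simp add: matrix_vector_mult_diff_rdistrib mat_mult_vector norm_vector_scalar_mult algebra_simps)
  qed
  have inv: "invertible (mat z - A)" if z: "norm z > K" for z
    unfolding invertible_left_inverse matrix_left_invertible_ker
  proof (intro allI impI)
    fix x assume "(mat z - A) *v x = 0"
    then have "norm x * (norm z - K) \<le> 0" using low[of x z] by simp
    with z show "x = 0" by (simp add: mult_le_0_iff)
  qed
  show ?thesis
  proof (rule that[of K])
    fix z :: complex and v assume z: "norm z > K"
    show "norm (matrix_inv (mat z - A) *v v) \<le> norm v / (norm z - K)"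
      using low[of "matrix_inv (mat z - A) *v v" z] z
      by (simp add: matrix_vector_mul_assoc matrix_inv_mult inv field_simps)
  qed (use K inv in auto)
qed

lemma resolvent_eventually_invertible:
  fixes A :: "complex^'n^'n"
  shows "\<forall>\<^sub>F z in at_infinity. invertible (mat z - A)"
proof -
  obtain K where "\<And>z::complex. norm z > K \<Longrightarrow> invertible (mat z - A)"
    using resolvent_bound[of A] by metis
  then show ?thesis
    unfolding eventually_at_infinity by (metis gt_ex less_le_trans)
qed

lemma resolvent_tendsto_0:
  fixes A :: "complex^'n^'n" and C :: "complex^'n^'m"
  shows "((\<lambda>z. C *v (matrix_inv (mat z - A) *v v)) \<longlongrightarrow> 0) at_infinity"
proof -
  obtain K where K: "\<And>z v. norm z > K \<Longrightarrow> norm (matrix_inv (mat z - A) *v v) \<le> norm v / (norm z - K)"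
    using resolvent_bound[of A] by metis
  have "((\<lambda>z. matrix_inv (mat z - A) *v v) \<longlongrightarrow> 0) at_infinity"
  proof (rule Lim_null_comparison)
    show "\<forall>\<^sub>F z in at_infinity. norm (matrix_inv (mat z - A) *v v) \<le> norm v / (norm z - K)"
      unfolding eventually_at_infinity by (metis K gt_ex less_le_trans)
    have "filterlim (\<lambda>z::complex. - K + norm z) at_top at_infinity"
      by (intro filterlim_tendsto_add_at_top[OF tendsto_const] filterlim_norm_at_top)
    then show "((\<lambda>z::complex. norm v / (norm z - K)) \<longlongrightarrow> 0) at_infinity"
      by (intro tendsto_divide_0[OF tendsto_const] filterlim_at_top_imp_at_infinity) simp
  qed
  from bounded_linear.tendsto[OF matrix_vector_mul_bounded_linear this] show ?thesis
    by simp
qed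

text \<open>One term of the Neumann series split off exactly, so that Markov parameters can be
  extracted without expanding the resolvent.\<close>

lemma resolvent_step:
  fixes A :: "'a::field^'n^'n"
  assumes inv: "invertible (mat z - A)"
  shows "z *s (matrix_inv (mat z - A) *v v) = v + matrix_inv (mat z - A) *v (A *v v)"
proof -
  let ?R = "matrix_inv (mat z - A)"
  have "v = ?R *v ((mat z - A) *v v)"
    by (simp add: matrix_vector_mul_assoc matrix_inv_mult inv)
  then show ?thesis
    by (simp add: matrix_vector_mult_diff_rdistrib mat_mult_vector vector_scalar_commute
        matrix_vector_mult_diff_distrib eq_diff_eq)
qed

text \<open>Multiplying by z turns C R(z) b into C b + C R(z) A b. The last term vanishes at
  infinity, so the values C b agree; cancelling them leaves the same hypothesis for A b, and the
  argument repeats.\<close>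

lemma resolvent_eq_imp_markov_eq:
  fixes A1 :: "complex^'n1^'n1" and A2 :: "complex^'n2^'n2"
    and C1 :: "complex^'n1^'m" and C2 :: "complex^'n2^'m"
  assumes "\<forall>\<^sub>F z in at_infinity. C1 *v (matrix_inv (mat z - A1) *v b1)
             = C2 *v (matrix_inv (mat z - A2) *v b2)"
  shows "C1 *v (((*v) A1 ^^ n) b1) = C2 *v (((*v) A2 ^^ n) b2)"
proof -
  let ?F1 = "\<lambda>b z. C1 *v (matrix_inv (mat z - A1) *v b)"
  let ?F2 = "\<lambda>b z. C2 *v (matrix_inv (mat z - A2) *v b)"
  have step: "C1 *v b1 = C2 *v b2 \<and> (\<forall>\<^sub>F z in at_infinity. ?F1 (A1 *v b1) z = ?F2 (A2 *v b2) z)"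
    if "\<forall>\<^sub>F z in at_infinity. ?F1 b1 z = ?F2 b2 z" for b1 b2
  proof -
    have ev: "\<forall>\<^sub>F z in at_infinity. C1 *v b1 + ?F1 (A1 *v b1) z = C2 *v b2 + ?F2 (A2 *v b2) z"
      using that resolvent_eventually_invertible[of A1] resolvent_eventually_invertible[of A2]
    proof eventually_elim
      case (elim z)
      have "z *s ?F1 b1 z = C1 *v b1 + ?F1 (A1 *v b1) z"
        by (simp only: vector_scalar_commute[of C1, symmetric] resolvent_step[OF elim(2)]
            matrix_vector_right_distrib)
      moreover have "z *s ?F2 b2 z = C2 *v b2 + ?F2 (A2 *v b2) z"
        by (simp only: vector_scalar_commute[of C2, symmetric] resolvent_step[OF elim(3)]
            matrix_vector_right_distrib)
      ultimately show ?case using elim(1) by simp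
    qed
    have "((\<lambda>z. C1 *v b1 + ?F1 (A1 *v b1) z) \<longlongrightarrow> C1 *v b1 + 0) at_infinity"
      by (intro tendsto_add tendsto_const resolvent_tendsto_0)
    \<comment> \<open>By \<open>ev\<close> the same function also equals the expression of the
      second model near infinity, which gives it a second limit.\<close>
    moreover have "((\<lambda>z. C1 *v b1 + ?F1 (A1 *v b1) z) \<longlongrightarrow> C2 *v b2 + 0) at_infinity"
      using ev by (rule tendsto_cong[THEN iffD2]) (intro tendsto_add tendsto_const resolvent_tendsto_0)
    ultimately have "C1 *v b1 = C2 *v b2"
      using tendsto_unique[OF trivial_limit_at_infinity] by fastforce
    with ev show ?thesis by simp
  qed
  have "\<forall>\<^sub>F z in at_infinity. ?F1 (((*v) A1 ^^ n) b1) z = ?F2 (((*v) A2 ^^ n) b2) z" for n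
  proof (induction n)
    case 0
    show ?case using assms by simp
  next
    case (Suc n)
    from step[OF this] show ?case by simp
  qed
  with step show ?thesis by blast
qed

lemma transfer_function_eq_imp_markov_eq:
  fixes A1 :: "real^'n1^'n1" and A2 :: "real^'n2^'n2"
    and B1 :: "real^'k^'n1" and B2 :: "real^'k^'n2"
    and C1 :: "real^'n1^'m" and C2 :: "real^'n2^'m"
  assumes "\<forall>\<^sub>F z in at_infinity. transfer_function A1 B1 C1 z = transfer_function A2 B2 C2 z"
  shows "C1 *v (((*v) A1 ^^ n) (B1 *v u)) = C2 *v (((*v) A2 ^^ n) (B2 *v u))"
proof -
  have "complex_matrix C1 *v (((*v) (complex_matrix A1) ^^ n) (complex_vector (B1 *v u)))
      = complex_matrix C2 *v (((*v) (complex_matrix A2) ^^ n) (complex_vector (B2 *v u)))"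
  proof (rule resolvent_eq_imp_markov_eq)
    show "\<forall>\<^sub>F z in at_infinity.
        complex_matrix C1 *v (matrix_inv (mat z - complex_matrix A1) *v complex_vector (B1 *v u)) =
        complex_matrix C2 *v (matrix_inv (mat z - complex_matrix A2) *v complex_vector (B2 *v u))"
      using assms
    proof eventually_elim
      case (elim z)
      then have "transfer_function A1 B1 C1 z *v complex_vector u = transfer_function A2 B2 C2 z *v complex_vector u"
        by simp
      then show ?case
        by (simp only: transfer_function_def complex_matrix_mult_vector flip: matrix_vector_mul_assoc)
    qed
  qed
  then show ?thesis
    by (simp only: complex_matrix_funpow_vector complex_matrix_mult_vector complex_vector_eq_iff)
qed

subsection \<open>Isomorphism of realizations\<close>

text \<open>The eigenvector test of Popov, Belevitch and Hautus.\<close>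

lemma observable_if_no_unobservable_eigenvector:
  fixes A :: "real^'n^'n" and C :: "real^'n^'m"
  assumes pbh: "\<And>z v. complex_matrix A *v v = z *s v \<Longrightarrow> complex_matrix C *v v = 0 \<Longrightarrow> v = 0"
    and y: "\<And>n. C *v (((*v) A ^^ n) y) = 0"
  shows "y = 0"
proof (rule ccontr)
  assume "y \<noteq> 0"
  \<comment> \<open>The unobservable subspace of the complexified pair is invariant, so a nonzero
    \<open>y\<close> in it would force an eigenvector in it.\<close>
  define V where "V = {v. \<forall>n. complex_matrix C *v (((*v) (complex_matrix A) ^^ n) v) = 0}"
  note hom = funpow_matrix_vector_linear[THEN Vector_Spaces.linear.axioms(3)]
  have "vec.subspace V"
    unfolding vec.subspace_def V_def
    by (auto simp: module_hom.add[OF hom] module_hom.scale[OF hom] module_hom.zero[OF hom]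
        matrix_vector_right_distrib vector_scalar_commute)
  moreover have "complex_matrix A *v v \<in> V" if "v \<in> V" for v
    using that unfolding V_def by (simp flip: funpow_Suc_right[THEN fun_cong, unfolded o_apply] del: funpow.simps)
  moreover have "complex_vector y \<in> V"
    using y by (simp add: V_def complex_matrix_funpow_vector complex_matrix_mult_vector flip: zero_vec_def)
  moreover have "complex_vector y \<noteq> 0" using \<open>y \<noteq> 0\<close> by simp
  ultimately obtain z w where w: "w \<in> V" "w \<noteq> 0" "complex_matrix A *v w = z *s w"
    by (rule eigenvector_in_invariant_subspace)
  from w(1) have "complex_matrix C *v (((*v) (complex_matrix A) ^^ 0) w) = 0"
    unfolding V_def by blast
  with pbh[OF w(3)] w(2) show False by simp
qed

text \<open>Feeding both models the same inputs yields pairs of states. Controllability of the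
  second model lets every state occur as a second component, and observability makes the first
  component determine the second. Since the dimensions are equal, these pairs form the graph of an
  invertible map.\<close>

lemma realization_isomorphism:
  fixes A1 A2 :: "real^'n^'n" and B1 B2 :: "real^'k^'n" and C1 C2 :: "real^'n^'m"
  assumes markov: "\<And>n u. C1 *v (((*v) A1 ^^ n) (B1 *v u)) = C2 *v (((*v) A2 ^^ n) (B2 *v u))"
    and controllable: "\<And>V. subspace V \<Longrightarrow> (\<And>u. B2 *v u \<in> V) \<Longrightarrow> (\<And>v. v \<in> V \<Longrightarrow> A2 *v v \<in> V) \<Longrightarrow> V = UNIV"
    and observable: "\<And>y. (\<And>n. C2 *v (((*v) A2 ^^ n) y) = 0) \<Longrightarrow> y = 0"
  obtains S where "invertible S" "A1 ** S = S ** A2" "S ** B2 = B1" "C1 ** S = C2"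
proof -
  define G where "G = span {(((*v) A1 ^^ n) (B1 *v u), ((*v) A2 ^^ n) (B2 *v u)) | n u. True}"
  have lin: "linear ((*v) A ^^ n)" for A :: "real^'n^'n" and n
    by (rule linear_matrix_vector_mul_eq[THEN iffD1, OF funpow_matrix_vector_linear])
  have base: "(((*v) A1 ^^ n) (B1 *v u), ((*v) A2 ^^ n) (B2 *v u)) \<in> G" for n u
    unfolding G_def by (rule span_base) blast
  have sub: "subspace G" by (simp add: G_def)
  have step: "(A1 *v fst g, A2 *v snd g) \<in> G" if "g \<in> G" for g
    using that unfolding G_def
  proof (induction rule: span_induct)
    case base
    have "linear (\<lambda>g. (A1 *v fst g, A2 *v snd g))"
      by (rule linearI) (simp_all add: algebra_simps)
    from linear_subspace_vimage[OF this sub] show ?case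
      by (simp add: G_def vimage_def)
  next
    case (step g)
    then obtain n u where "g = (((*v) A1 ^^ n) (B1 *v u), ((*v) A2 ^^ n) (B2 *v u))" by auto
    then show ?case using base[of "Suc n" u] by (simp add: G_def)
  qed
  \<comment> \<open>Equality of the Markov parameters says exactly that paired states produce the
    same outputs; it is checked on the generators of \<open>G\<close>.\<close>
  have out: "C1 *v (((*v) A1 ^^ n) (fst g)) = C2 *v (((*v) A2 ^^ n) (snd g))" if "g \<in> G" for g n
    using that unfolding G_def
  proof (induction rule: span_induct)
    case base
    show ?case
      by (auto simp: subspace_def linear_add[OF lin] linear_cmul[OF lin] linear_0[OF lin] algebra_simps)
  next
    case (step g)
    then obtain m u where "g = (((*v) A1 ^^ m) (B1 *v u), ((*v) A2 ^^ m) (B2 *v u))" by auto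
    then show ?case using markov[of "n + m" u] by (simp add: funpow_add)
  qed
  have "snd ` G = UNIV"
  proof (rule controllable)
    show "subspace (snd ` G)" using sub by (intro linear_subspace_image linear_snd)
    show "B2 *v u \<in> snd ` G" for u
      using base[of 0 u] by (force simp: image_iff)
    show "A2 *v v \<in> snd ` G" if "v \<in> snd ` G" for v
      using that step by (force simp: image_iff)
  qed
  then have "axis i 1 \<in> snd ` G" for i :: 'n
    by simp
  then have "\<exists>x. (x, axis i 1) \<in> G" for i :: 'n
    unfolding image_iff by (metis prod.collapse)
  then obtain x where x: "\<And>i. (x i, axis i 1) \<in> G" by metis
  \<comment> \<open>Column j is some state paired with the j-th unit vector. That it is the only
    such state is established later, in \<open>fst_eq\<close>.\<close>
  define S :: "real^'n^'n" where "S = (\<chi> i j. x j $ i)"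
  have S: "(S *v y, y) \<in> G" for y
  proof -
    have "(\<Sum>i\<in>UNIV. y $ i *\<^sub>R (x i, axis i 1)) \<in> G"
      by (intro subspace_sum sub subspace_scale x)
    also have "(\<Sum>i\<in>UNIV. y $ i *\<^sub>R (x i, axis i 1)) = (S *v y, y)"
      by (simp add: sum_prod S_def vec_eq_iff matrix_vector_mult_def mult.commute
          axis_def if_distrib[where f = "\<lambda>x. _ * x"] cong: if_cong)
    finally show ?thesis .
  qed
  \<comment> \<open>A state paired with 0 has zero output at all times, hence is
    unobservable.\<close>
  have fst_0: "snd g = 0" if "g \<in> G" "fst g = 0" for g
  proof (rule observable)
    show "C2 *v (((*v) A2 ^^ n) (snd g)) = 0" for n
      using out[OF that(1), of n] by (simp add: that(2) linear_0[OF lin])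
  qed
  have inv: "invertible S"
    unfolding invertible_left_inverse matrix_left_invertible_ker
  proof (intro allI impI)
    fix y assume "S *v y = 0"
    then show "y = 0" using fst_0[OF S[of y]] by simp
  qed
  \<comment> \<open>Now \<open>G\<close> is exactly the graph of \<open>S\<close>: subtracting the
    graph point with the same first component leaves a pair with first component 0. The three
    identities follow by applying this, or \<open>out\<close>, to suitable members of
    \<open>G\<close>.\<close>
  have fst_eq: "S *v snd g = fst g" if "g \<in> G" for g
  proof -
    have "surj ((*v) S)"
      using inv by (simp add: invertible_right_inverse matrix_right_invertible_surjective)
    then obtain y where y: "fst g = S *v y" by (rule surjE)
    have "g - (S *v y, y) \<in> G" using sub that S by (rule subspace_diff)
    then have "snd (g - (S *v y, y)) = 0" by (rule fst_0) (simp add: y)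
    then show ?thesis using y by simp
  qed
  show ?thesis
  proof (rule that[OF inv])
    show "A1 ** S = S ** A2"
      using fst_eq[OF step[OF S]] by (simp add: matrix_eq flip: matrix_vector_mul_assoc)
    show "S ** B2 = B1"
      using fst_eq[OF base[of 0]] by (simp add: matrix_eq flip: matrix_vector_mul_assoc)
    show "C1 ** S = C2"
      using out[OF S, of 0] by (simp add: matrix_eq flip: matrix_vector_mul_assoc)
  qed
qed

text \<open>\<open>S\<close> maps eigenvectors of \<open>A2\<close> to eigenvectors of
  \<open>A1\<close>, injectivity keeping them nonzero.\<close>

lemma spectrum_subset_if_intertwined:
  fixes A1 A2 S :: "real^'n^'n"
  assumes "invertible S" and A: "A1 ** S = S ** A2"
  shows "spectrum A2 \<subseteq> spectrum A1"
proof
  fix z assume "z \<in> spectrum A2"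
  then obtain v where v: "v \<noteq> 0" "complex_matrix A2 *v v = z *s v"
    by (auto simp: spectrum_def)
  obtain R where "R ** S = mat 1"
    using assms(1) by (auto simp: invertible_def)
  then have "complex_matrix R *v (complex_matrix S *v v) = v"
    by (simp add: matrix_vector_mul_assoc flip: complex_matrix_mult)
  with v(1) have "complex_matrix S *v v \<noteq> 0" by auto
  moreover have "complex_matrix A1 *v (complex_matrix S *v v) = complex_matrix S *v (complex_matrix A2 *v v)"
    by (simp add: matrix_vector_mul_assoc A flip: complex_matrix_mult)
  ultimately show "z \<in> spectrum A1"
    by (auto simp: spectrum_def v(2) vector_scalar_commute)
qed

text \<open>From (z - A1) S = S (z - A2) the intertwining passes to the resolvents, and
  \<open>S\<close> is then absorbed into the input and output matrices.\<close>

lemma transfer_function_intertwine: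
  fixes S :: "real^'n2^'n1"
  assumes A: "A1 ** S = S ** A2" and B: "S ** B2 = B1" and C: "C1 ** S = C2"
    and z: "z \<notin> spectrum A1" "z \<notin> spectrum A2"
  shows "transfer_function A1 B1 C1 z = transfer_function A2 B2 C2 z"
proof -
  let ?R1 = "matrix_inv (mat z - complex_matrix A1)" and ?R2 = "matrix_inv (mat z - complex_matrix A2)"
  let ?S = "complex_matrix S"
  note inv = z[unfolded not_in_spectrum_iff]
  have "complex_matrix A1 *v (?S *v x) = ?S *v (complex_matrix A2 *v x)" for x
    by (simp add: matrix_vector_mul_assoc A flip: complex_matrix_mult)
  then have "(mat z - complex_matrix A1) *v (?S *v x) = ?S *v ((mat z - complex_matrix A2) *v x)" for x
    by (simp add: matrix_vector_mult_diff_rdistrib matrix_vector_mult_diff_distrib mat_mult_vector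
        vector_scalar_commute)
  from this[of "?R2 *v x" for x] have "(mat z - complex_matrix A1) *v (?S *v (?R2 *v x)) = ?S *v x" for x
    by (simp add: matrix_vector_mul_assoc[of _ ?R2] matrix_inv_mult(1)[OF inv(2)])
  from arg_cong[OF this, of "(*v) ?R1"] have "?S *v (?R2 *v x) = ?R1 *v (?S *v x)" for x
    by (simp add: matrix_vector_mul_assoc[of ?R1] matrix_inv_mult(2)[OF inv(1)])
  then show ?thesis
    by (simp add: transfer_function_def matrix_eq complex_matrix_mult flip: matrix_vector_mul_assoc B C)
qed

subsection \<open>Matrix exponentials and solutions\<close>

lemma bilinear_matrix_mult: "bilinear ((**) :: real^'n^'m \<Rightarrow> real^'k^'n \<Rightarrow> real^'k^'m)"
proof -
  have "linear (\<lambda>Y :: real^'k^'n. X ** Y)" for X :: "real^'n^'m"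
    by (rule linearI) (simp_all add: matrix_add_ldistrib matrix_scalar_ac scalar_matrix_assoc)
  moreover have "linear (\<lambda>X :: real^'n^'m. X ** Y)" for Y :: "real^'k^'n"
    by (rule linearI)
       (simp_all add: matrix_eq matrix_vector_mult_add_rdistrib scalar_matrix_assoc flip: matrix_vector_mul_assoc)
  ultimately show ?thesis
    unfolding bilinear_def by blast
qed

text \<open>Comparison with the exponential series of K times the norm of A, where K bounds the
  bilinear matrix product.\<close>

lemma summable_matrix_exp:
  fixes A :: "real^'n^'n"
  shows "summable (\<lambda>n. (1 / fact n) *\<^sub>R (((**) A ^^ n) (mat 1)))"
proof -
  obtain K where K: "K > 0" "\<And>X Y :: real^'n^'n. norm ((X :: real^'n^'n) ** Y) \<le> K * norm X * norm Y"
    using bilinear_bounded_pos[OF bilinear_matrix_mult] by metis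
  have bound: "norm (((**) A ^^ n) (mat 1)) \<le> (K * norm A) ^ n * norm (mat 1 :: real^'n^'n)" for n
  proof (induction n)
    case (Suc n)
    have "norm (((**) A ^^ Suc n) (mat 1)) \<le> K * norm A * norm (((**) A ^^ n) (mat 1))"
      using K(2)[of A "((**) A ^^ n) (mat 1)"] by simp
    also have "\<dots> \<le> K * norm A * ((K * norm A) ^ n * norm (mat 1 :: real^'n^'n))"
      using K(1) Suc by (intro mult_left_mono) auto
    finally show ?case by (simp add: mult.assoc)
  qed simp
  show ?thesis
  proof (rule summable_comparison_test')
    show "summable (\<lambda>n. inverse (fact n) * (K * norm A) ^ n * norm (mat 1 :: real^'n^'n))"
      by (intro summable_mult2 summable_exp)
    show "norm ((1 / fact n) *\<^sub>R (((**) A ^^ n) (mat 1)))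
        \<le> inverse (fact n) * (K * norm A) ^ n * norm (mat 1 :: real^'n^'n)" for n
      using bound[of n] by (simp add: divide_simps mult.assoc)
  qed
qed

text \<open>The powers are intertwined by induction, and multiplication by T on either side is
  bounded linear, so it may be applied termwise to the series.\<close>

lemma matrix_exp_intertwine:
  fixes T :: "real^'n^'m"
  assumes "A2 ** T = T ** A1"
  shows "matrix_exp A2 ** T = T ** matrix_exp A1"
proof -
  have pow: "((**) A2 ^^ n) (mat 1) ** T = T ** ((**) A1 ^^ n) (mat 1)" for n
  proof (induction n)
    case (Suc n)
    have "((**) A2 ^^ Suc n) (mat 1) ** T = A2 ** (T ** ((**) A1 ^^ n) (mat 1))"
      by (simp add: Suc flip: matrix_mul_assoc)
    also have "\<dots> = T ** ((**) A1 ^^ Suc n) (mat 1)"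
      by (simp add: matrix_mul_assoc assms)
    finally show ?case .
  qed simp
  have "bounded_linear (\<lambda>X. X ** T)" and "bounded_linear (\<lambda>X. T ** X)"
    using bilinear_matrix_mult by (auto simp: bilinear_def linear_conv_bounded_linear)
  note bl = this[THEN bounded_linear.suminf, OF summable_matrix_exp]
  show ?thesis
    unfolding matrix_exp_def bl
    by (simp add: pow matrix_scalar_ac flip: scalar_matrix_assoc)
qed

lemma borel_measurable_matrix_vector_mult [measurable]:
  fixes A :: "real^'n^'m"
  assumes "g \<in> borel_measurable M"
  shows "(\<lambda>\<omega>. A *v g \<omega>) \<in> borel_measurable M"
  by (rule borel_measurable_continuous_on[OF linear_continuous_on[OF matrix_vector_mul_bounded_linear] assms])

text \<open>T passes through each Riemann sum, and convergence in probability survives a bounded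
  linear map.\<close>

lemma has_levy_integral_matrix_mult:
  fixes T :: "real^'n^'m"
  assumes "prob_space M" and L: "\<And>t. L t \<in> borel_measurable M"
    and J: "has_levy_integral M L f s t J"
  shows "has_levy_integral M L (\<lambda>u. T ** f u) s t (\<lambda>\<omega>. T *v J \<omega>)"
proof -
  interpret prob_space M by fact
  note [measurable] = L
  have [measurable]: "J \<in> borel_measurable M" using J by (simp add: has_levy_integral_def)
  obtain K where K: "K > 0" "\<And>x. norm (T *v x) \<le> norm x * K"
    using bounded_linear.pos_bounded[OF matrix_vector_mul_bounded_linear, of T] by blast
  let ?R = "\<lambda>f D \<omega>. \<Sum>(x, I)\<in>D. f x *v (L (Sup I) \<omega> - L (Inf I) \<omega>)"
  have R: "?R (\<lambda>u. T ** f u) D \<omega> = T *v ?R f D \<omega>" for D \<omega>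
    by (simp only: vec.sum case_prod_unfold matrix_vector_mul_assoc)
  show ?thesis
    unfolding has_levy_integral_def
  proof (intro conjI allI impI)
    show "(\<lambda>\<omega>. T *v J \<omega>) \<in> borel_measurable M" by measurable
    fix \<epsilon> :: real assume "\<epsilon> > 0"
    \<comment> \<open>The definition of the integral uses one number both as error threshold and as
      probability bound: \<epsilon> / K serves the first purpose and \<epsilon> the second.\<close>
    define \<eta> where "\<eta> = min \<epsilon> (\<epsilon> / K)"
    have "\<eta> > 0" using \<open>\<epsilon> > 0\<close> K(1) by (simp add: \<eta>_def)
    from J[unfolded has_levy_integral_def, THEN conjunct2, rule_format, OF this]
    obtain \<delta> where "\<delta> > 0" and \<delta>: "\<And>D. D tagged_division_of {s..t} \<Longrightarrow> (\<lambda>x. ball x \<delta>) fine D \<Longrightarrow>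
        measure M {\<omega> \<in> space M. \<eta> < norm (?R f D \<omega> - J \<omega>)} < \<eta>"
      by blast
    have "measure M {\<omega> \<in> space M. \<epsilon> < norm (?R (\<lambda>u. T ** f u) D \<omega> - T *v J \<omega>)} < \<epsilon>"
      if D: "D tagged_division_of {s..t}" "(\<lambda>x. ball x \<delta>) fine D" for D
    proof -
      have "{\<omega> \<in> space M. \<epsilon> < norm (?R (\<lambda>u. T ** f u) D \<omega> - T *v J \<omega>)}
          \<subseteq> {\<omega> \<in> space M. \<eta> < norm (?R f D \<omega> - J \<omega>)}"
      proof safe
        fix \<omega> assume "\<epsilon> < norm (?R (\<lambda>u. T ** f u) D \<omega> - T *v J \<omega>)"
        also have "\<dots> \<le> norm (?R f D \<omega> - J \<omega>) * K"
          unfolding R using K(2) by (simp flip: matrix_vector_mult_diff_distrib)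
        finally have "\<epsilon> / K < norm (?R f D \<omega> - J \<omega>)"
          using K(1) by (simp add: divide_less_eq)
        then show "\<eta> < norm (?R f D \<omega> - J \<omega>)" by (simp add: \<eta>_def)
      qed
      then have "measure M {\<omega> \<in> space M. \<epsilon> < norm (?R (\<lambda>u. T ** f u) D \<omega> - T *v J \<omega>)}
          \<le> measure M {\<omega> \<in> space M. \<eta> < norm (?R f D \<omega> - J \<omega>)}"
        by (rule finite_measure_mono) measurable
      also have "\<dots> < \<eta>" by (rule \<delta>[OF D])
      also have "\<dots> \<le> \<epsilon>" by (simp add: \<eta>_def)
      finally show ?thesis .
    qed
    with \<open>\<delta> > 0\<close> show "\<exists>\<delta>>0. \<forall>D. D tagged_division_of {s..t} \<and> (\<lambda>x. ball x \<delta>) fine D \<longrightarrow>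
        measure M {\<omega> \<in> space M. \<epsilon> < norm (?R (\<lambda>u. T ** f u) D \<omega> - T *v J \<omega>)} < \<epsilon>"
      by blast
  qed
qed

text \<open>If X is a state process of the first model, T X is one of the second with the same
  output. Used with an isomorphism and with its inverse, this gives an equivalence.\<close>

lemma ssm_solution_intertwine:
  fixes T :: "real^'n^'m"
  assumes levy: "levy_process M L"
    and A: "A2 ** T = T ** A1" and B: "T ** B1 = B2" and C: "C2 ** T = C1"
    and sol: "ssm_solution M A1 B1 C1 L Y"
  shows "ssm_solution M A2 B2 C2 L Y"
proof -
  have M: "prob_space M" "\<And>t. L t \<in> borel_measurable M"
    using levy by (auto simp: levy_process_def)
  obtain X where X: "state_process M L A1 B1 X" and Y: "\<And>t. Y t \<in> borel_measurable M"
    and CX: "\<And>t. AE \<omega> in M. Y t \<omega> = C1 *v X t \<omega>"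
    using sol by (auto simp: ssm_solution_def)
  have exp: "matrix_exp (c *\<^sub>R A2) ** T = T ** matrix_exp (c *\<^sub>R A1)" for c
    by (rule matrix_exp_intertwine) (simp add: A matrix_scalar_ac flip: scalar_matrix_assoc)
  have "state_process M L A2 B2 (\<lambda>t \<omega>. T *v X t \<omega>)"
    unfolding state_process_def
  proof (intro conjI allI impI)
    show "(\<lambda>\<omega>. T *v X t \<omega>) \<in> borel_measurable M" for t
      using X by (simp add: state_process_def borel_measurable_matrix_vector_mult)
    fix s t :: real assume "s < t"
    then obtain J where J: "has_levy_integral M L (\<lambda>u. matrix_exp ((t - u) *\<^sub>R A1) ** B1) s t J"
      and XJ: "AE \<omega> in M. X t \<omega> = matrix_exp ((t - s) *\<^sub>R A1) *v X s \<omega> + J \<omega>"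
      using X unfolding state_process_def by blast
    have "has_levy_integral M L (\<lambda>u. matrix_exp ((t - u) *\<^sub>R A2) ** B2) s t (\<lambda>\<omega>. T *v J \<omega>)"
      using has_levy_integral_matrix_mult[OF M J, of T]
      by (simp add: matrix_mul_assoc exp flip: B)
    moreover have "AE \<omega> in M. T *v X t \<omega> = matrix_exp ((t - s) *\<^sub>R A2) *v (T *v X s \<omega>) + T *v J \<omega>"
      using XJ by eventually_elim (simp add: matrix_vector_right_distrib matrix_vector_mul_assoc exp)
    ultimately show "\<exists>J. has_levy_integral M L (\<lambda>u. matrix_exp ((t - u) *\<^sub>R A2) ** B2) s t J \<and>
        (AE \<omega> in M. T *v X t \<omega> = matrix_exp ((t - s) *\<^sub>R A2) *v (T *v X s \<omega>) + J \<omega>)"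
      by blast
  qed
  moreover have "AE \<omega> in M. Y t \<omega> = C2 *v (T *v X t \<omega>)" for t
    using CX[of t] by eventually_elim (simp add: matrix_vector_mul_assoc C)
  ultimately show ?thesis
    using Y by (auto simp: ssm_solution_def intro!: exI[of _ "\<lambda>t \<omega>. T *v X t \<omega>"])
qed

subsection \<open>The block companion realization\<close>

lemma block_number_less: "block_number (i :: 'p::{finite,linorder}) < CARD('p)"
  unfolding block_number_def by (rule psubset_card_mono) auto

lemma block_number_strict_mono: "strict_mono (block_number :: 'p::{finite,linorder} \<Rightarrow> nat)"
  unfolding strict_mono_def block_number_def by (auto intro!: psubset_card_mono)

lemma block_number_eq_iff [simp]: "block_number i = block_number j \<longleftrightarrow> i = j"
  using strict_mono_eq[OF block_number_strict_mono] .

lemma bij_betw_block_number: "bij_betw block_number (UNIV :: 'p::{finite,linorder} set) {..<CARD('p)}"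
proof -
  have inj: "inj (block_number :: 'p \<Rightarrow> nat)" by (simp add: inj_on_def)
  moreover have "range (block_number :: 'p \<Rightarrow> nat) = {..<CARD('p)}"
    by (rule card_subset_eq) (auto simp: block_number_less card_image inj)
  ultimately show ?thesis by (simp add: bij_betw_def)
qed

lemma obtain_block_number:
  assumes "n < CARD('p)"
  obtains i :: "'p::{finite,linorder}" where "block_number i = n"
  using bij_betw_imp_surj_on[OF bij_betw_block_number] assms by (metis (full_types) imageE lessThan_iff)

lemma obtain_last_block:
  obtains i :: "'p::{finite,linorder}" where "block_number i = CARD('p) - 1"
proof -
  have "0 < CARD('p)" by simp
  then have "CARD('p) - 1 < CARD('p)" by linarith
  then show ?thesis using that by (rule obtain_block_number)
qed

lemma sum_block_number:
  "(\<Sum>i\<in>UNIV. f (block_number (i :: 'p::{finite,linorder}))) = (\<Sum>n<CARD('p). f n)"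
  by (rule sum.reindex_bij_betw[OF bij_betw_block_number])

section \<open>Action of the companion matrices on block vectors\<close>

lemma sum_UNIV_prod: "(\<Sum>r\<in>UNIV. f r) = (\<Sum>i\<in>UNIV. \<Sum>a\<in>UNIV. f (i, a))"
  by (simp add: sum.cartesian_product)

text \<open>The scalars are kept general: the complex instance serves eigenvectors, the real one the
  study of intertwiners.\<close>

lemma companion_A_mult_shift:
  fixes w :: "'a::real_algebra_1^('p::{finite,linorder} \<times> 'k::finite)"
  assumes "block_number j = Suc (block_number i)"
  shows "(map_matrix of_real (companion_A A) *v w) $ (i, a) = w $ (j, a)"
proof -
  have "block_number i \<noteq> CARD('p) - 1"
    using block_number_less[of j] assms by simp
  then have "of_real (companion_A A $ (i, a) $ c) = (if c = (j, a) then 1 else (0 :: 'a))" for c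
    by (cases c) (auto simp: companion_A_def mat_def simp flip: assms)
  then show ?thesis
    by (simp add: matrix_vector_mult_def if_distrib[where f = "\<lambda>x. x * _"] cong: if_cong)
qed

lemma companion_A_mult_last:
  fixes w :: "'a::real_algebra_1^('p::{finite,linorder} \<times> 'k::finite)"
  assumes "block_number i = CARD('p) - 1"
  shows "(map_matrix of_real (companion_A A) *v w) $ (i, a)
    = - (\<Sum>j\<in>UNIV. (map_matrix of_real (A (CARD('p) - block_number j)) *v (\<chi> b. w $ (j, b))) $ a)"
  using assms
  by (simp add: matrix_vector_mult_def companion_A_def sum_negf sum_UNIV_prod)

lemma companion_B_mult:
  fixes u :: "'a::real_algebra_1^'k"
  shows "(map_matrix of_real (companion_B :: real^'k^('p::{finite,linorder} \<times> 'k::finite)) *v u) $ (i, a)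
    = (if block_number i = CARD('p) - 1 then u $ a else 0)"
  by (simp add: matrix_vector_mult_def companion_B_def mat_def
      if_distrib[where f = of_real] if_distrib[where f = "\<lambda>x. x * _"] cong: if_cong)

text \<open>This is the stacked vector (w, z w, ..., z^(p-1) w), the shape of eigenvectors of the
  companion matrix and of the states (z - A)^(-1) B u.\<close>

definition block_powers :: "complex \<Rightarrow> complex^'k \<Rightarrow> complex^('p::{finite,linorder} \<times> 'k::finite)" where
  "block_powers z w = (\<chi> r. z ^ block_number (fst r) * w $ snd r)"

lemma sum_matrix_vector_mult: "(\<Sum>i\<in>I. f i) *v w = (\<Sum>i\<in>I. f i *v w)"
  by (induction I rule: infinite_finite_induct) (simp_all add: matrix_vector_mult_add_rdistrib)

text \<open>Reindexing by ascending powers matches the coefficients with block numbers.\<close>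

lemma monic_matpoly_mult:
  "monic_matpoly p A z *v w = z ^ p *s w + (\<Sum>n<p. z ^ n *s (complex_matrix (A (p - n)) *v w))"
proof -
  have "(\<Sum>i = 1..p. mat (z ^ (p - i)) ** complex_matrix (A i))
      = (\<Sum>n<p. mat (z ^ n) ** complex_matrix (A (p - n)))"
    by (rule sum.reindex_bij_witness[of _ "\<lambda>n. p - n" "\<lambda>i. p - i"]) auto
  then show ?thesis
    by (simp add: monic_matpoly_def matrix_vector_mult_add_rdistrib mat_mult_vector
        sum_matrix_vector_mult flip: matrix_vector_mul_assoc)
qed

lemma matpoly_mult: "matpoly q C z *v w = (\<Sum>n\<le>q. z ^ n *s (complex_matrix (C n) *v w))"
  by (simp add: matpoly_def mat_mult_vector sum_matrix_vector_mult flip: matrix_vector_mul_assoc)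

text \<open>The shift rows multiply by z, and the last row misses z^p w by P(z) w. Rearranged, (z -
  A) applied to the block powers of w is B P(z) w; this identity underlies the transfer function,
  observability and the recovery of P.\<close>

lemma companion_A_block_powers:
  "complex_matrix (companion_A A) *v (block_powers z w :: complex^('p::{finite,linorder} \<times> 'k::finite))
    = z *s block_powers z w - complex_matrix companion_B *v (monic_matpoly CARD('p) A z *v w)"
    (is "?l = ?r")
proof -
  have "?l $ (i, a) = ?r $ (i, a)" for i a
  proof (cases "block_number i = CARD('p) - 1")
    case True
    have "(\<chi> b. (block_powers z w :: complex^('p \<times> 'k)) $ (j, b)) = z ^ block_number j *s w" for j
      by (simp add: block_powers_def vec_eq_iff)
    then have "?l $ (i, a)
        = - (\<Sum>j\<in>(UNIV :: 'p set). z ^ block_number j * (complex_matrix (A (CARD('p) - block_number j)) *v w) $ a)"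
      by (simp add: companion_A_mult_last[OF True] vector_scalar_commute)
    also have "\<dots> = - (\<Sum>n<CARD('p). z ^ n * (complex_matrix (A (CARD('p) - n)) *v w) $ a)"
      by (subst sum_block_number) simp
    \<comment> \<open>Reading \<open>power_Suc\<close> backwards merges z * z^(p-1) in the last
      block into the leading term z^p of P(z).\<close>
    also have "\<dots> = ?r $ (i, a)"
      by (simp add: companion_B_mult True monic_matpoly_mult block_powers_def power_Suc[symmetric]
          del: power_Suc)
    finally show ?thesis .
  next
    case False
    with block_number_less[of i] have "Suc (block_number i) < CARD('p)" by simp
    then obtain j :: 'p where "block_number j = Suc (block_number i)" by (rule obtain_block_number)
    with False show ?thesis
      by (simp add: companion_A_mult_shift companion_B_mult block_powers_def)
  qed
  then show ?thesis by (simp add: vec_eq_iff)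
qed

text \<open>The bound on \<open>q\<close> ensures that all coefficients of Q fit into the p block
  columns, the remaining ones being zero.\<close>

lemma companion_C_block_powers:
  assumes "q < CARD('p)"
  shows "complex_matrix (companion_C q C) *v (block_powers z w :: complex^('p::{finite,linorder} \<times> 'k::finite))
    = matpoly q C z *v w"
proof -
  have "(complex_matrix (companion_C q C) *v (block_powers z w :: complex^('p \<times> 'k))) $ a
      = (matpoly q C z *v w) $ a" for a
  proof -
    have "(complex_matrix (companion_C q C) *v (block_powers z w :: complex^('p \<times> 'k))) $ a
        = (\<Sum>j\<in>(UNIV::'p set). if block_number j \<le> q
             then z ^ block_number j * (complex_matrix (C (block_number j)) *v w) $ a else 0)"
      by (auto simp: sum_UNIV_prod matrix_vector_mult_def companion_C_def block_powers_def sum_distrib_left mult_ac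
          intro!: sum.cong)
    also have "\<dots> = (\<Sum>n<CARD('p). if n \<le> q then z ^ n * (complex_matrix (C n) *v w) $ a else 0)"
      by (rule sum_block_number)
    also have "\<dots> = (\<Sum>n\<le>q. z ^ n * (complex_matrix (C n) *v w) $ a)"
      by (rule sum.mono_neutral_cong_right) (use assms in auto)
    finally show ?thesis by (simp add: matpoly_mult)
  qed
  then show ?thesis by (simp add: vec_eq_iff)
qed

text \<open>The shift rows of the eigenvector equation make each block z times the preceding one, so
  block 0 determines \<open>v\<close>.\<close>

lemma companion_A_eigenvector:
  fixes v :: "complex^('p::{finite,linorder} \<times> 'k::finite)"
  assumes "complex_matrix (companion_A A) *v v = z *s v"
  obtains w where "v = block_powers z w"
proof -
  obtain i0 :: 'p where i0: "block_number i0 = 0"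
    by (rule obtain_block_number[of 0]) simp
  have "v $ (i, a) = z ^ n * v $ (i0, a)" if "block_number i = n" for n i a
    using that
  proof (induction n arbitrary: i)
    case 0
    with i0 have "i = i0" by (metis block_number_eq_iff)
    then show ?case by simp
  next
    case (Suc n)
    then have "n < CARD('p)" using block_number_less[of i] by simp
    then obtain j :: 'p where j: "block_number j = n" by (rule obtain_block_number)
    have "v $ (i, a) = z * v $ (j, a)"
      using companion_A_mult_shift[of i j A v a] Suc.prems j assms by simp
    with Suc.IH[OF j] show ?case by simp
  qed
  then have "v $ r = z ^ block_number (fst r) * v $ (i0, snd r)" for r
    by (metis prod.collapse)
  then have "v = block_powers z (\<chi> a. v $ (i0, a))"
    unfolding block_powers_def vec_eq_iff vec_lambda_beta by blast
  then show ?thesis by (rule that)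
qed

text \<open>For w = P(z)^(-1) u, the block powers of w solve (z - A) x = B u, and the output matrix
  sends them to Q(z) w.\<close>

lemma companion_transfer_function:
  fixes A C :: "nat \<Rightarrow> real^'k^'k"
  assumes "q < CARD('p)" and z: "z \<notin> spectrum (companion_A A :: real^('p::{finite,linorder} \<times> 'k)^('p \<times> 'k))"
    and P: "invertible (monic_matpoly CARD('p) A z)"
  shows "transfer_function (companion_A A :: real^('p \<times> 'k)^('p \<times> 'k)) companion_B (companion_C q C) z
    = matpoly q C z ** matrix_inv (monic_matpoly CARD('p) A z)"
proof -
  let ?A = "complex_matrix (companion_A A :: real^('p \<times> 'k)^('p \<times> 'k))"
  let ?P = "monic_matpoly CARD('p) A z"
  note inv = z[unfolded not_in_spectrum_iff]
  have "matrix_inv (mat z - ?A) *v (complex_matrix companion_B *v u) = block_powers z (matrix_inv ?P *v u)" for u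
  proof -
    have "(mat z - ?A) *v block_powers z (matrix_inv ?P *v u) = complex_matrix companion_B *v u"
      by (simp add: matrix_vector_mult_diff_rdistrib mat_mult_vector companion_A_block_powers)
         (simp add: matrix_vector_mul_assoc matrix_inv_mult[OF P])
    from arg_cong[OF this, of "(*v) (matrix_inv (mat z - ?A))"] show ?thesis
      by (simp add: matrix_vector_mul_assoc matrix_inv_mult(2)[OF inv])
  qed
  then show ?thesis
    by (simp add: transfer_function_def matrix_eq companion_C_block_powers[OF assms(1)]
        flip: matrix_vector_mul_assoc)
qed

text \<open>An unobservable eigenvector consists of block powers of some w with B P(z) w = 0 and
  Q(z) w = 0. As B is injective, coprimality gives w = 0.\<close>

lemma companion_observable:
  fixes A C :: "nat \<Rightarrow> real^'k^'k" and y :: "real^('p::{finite,linorder} \<times> 'k)"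
  assumes "q < CARD('p)" and coprime: "right_coprime (monic_matpoly CARD('p) A) (matpoly q C)"
    and y: "\<And>n. companion_C q C *v (((*v) (companion_A A) ^^ n) y) = 0"
  shows "y = 0"
proof (rule observable_if_no_unobservable_eigenvector[OF _ y])
  fix z and v :: "complex^('p \<times> 'k)"
  assume A: "complex_matrix (companion_A A) *v v = z *s v" and C: "complex_matrix (companion_C q C) *v v = 0"
  obtain w where v: "v = block_powers z w" using companion_A_eigenvector[OF A] .
  have B: "complex_matrix (companion_B :: real^'k^('p \<times> 'k)) *v (monic_matpoly CARD('p) A z *v w) = 0"
    using A unfolding v companion_A_block_powers by simp
  obtain i :: 'p where "block_number i = CARD('p) - 1"
    by (rule obtain_last_block)
  then have "(monic_matpoly CARD('p) A z *v w) $ a = 0" for a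
    using companion_B_mult[of "monic_matpoly CARD('p) A z *v w" i a] B by simp
  then have "monic_matpoly CARD('p) A z *v w = 0" by (simp add: vec_eq_iff)
  moreover have "matpoly q C z *v w = 0"
    using C unfolding v companion_C_block_powers[OF assms(1)] .
  ultimately have "w = 0" by (rule right_coprime_ker_trivial[OF coprime])
  then show "v = 0" by (simp add: v block_powers_def vec_eq_iff)
qed

section \<open>Controllability of the companion model and rigidity of its intertwiners\<close>

lemma companion_B_mult_axis:
  assumes "block_number i = CARD('p) - 1"
  shows "companion_B *v axis a 1 = (axis (i, a) 1 :: real^('p::{finite,linorder} \<times> 'k::finite))"
proof -
  have "block_number j = CARD('p) - 1 \<longleftrightarrow> j = i" for j
    using assms by (metis block_number_eq_iff)
  then have "(companion_B *v axis a 1) $ (j, b) = (axis (i, a) 1 :: real^('p \<times> 'k)) $ (j, b)" for j b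
    using companion_B_mult[where 'a = real and u = "axis a 1" and i = j and a = b]
    by (auto simp: axis_def map_matrix_def)
  then show ?thesis by (simp add: vec_eq_iff)
qed

text \<open>Read by columns, the companion matrix moves a unit vector one block back, up to a
  correction in the range of the input matrix.\<close>

lemma companion_A_mult_axis_Suc:
  assumes "block_number i = Suc (block_number j)"
  shows "companion_A A *v axis (i, a) 1
    = (axis (j, a) 1 :: real^('p::{finite,linorder} \<times> 'k::finite))
      - companion_B *v column a (A (CARD('p) - block_number i))"
proof -
  have "(companion_A A *v axis (i, a) 1) $ (l, b)
    = (axis (j, a) 1 - companion_B *v column a (A (CARD('p) - block_number i)) :: real^('p \<times> 'k)) $ (l, b)" for l b
    using companion_B_mult[where 'a = real and u = "column a (A (CARD('p) - block_number i))" and i = l and a = b]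
      block_number_less[of i] assms
    unfolding matrix_vector_mult_basis by (auto simp: column_def companion_A_def axis_def map_matrix_def mat_def)
  then show ?thesis by (simp add: vec_eq_iff)
qed

lemma companion_A_mult_axis_0:
  assumes "block_number i = 0"
  shows "companion_A A *v (axis (i, a) 1 :: real^('p::{finite,linorder} \<times> 'k::finite))
    = - (companion_B *v column a (A CARD('p)))"
proof -
  have "(companion_A A *v axis (i, a) 1) $ (l, b)
    = (- (companion_B *v column a (A CARD('p))) :: real^('p \<times> 'k)) $ (l, b)" for l b
    using companion_B_mult[where 'a = real and u = "column a (A CARD('p))" and i = l and a = b] assms
    unfolding matrix_vector_mult_basis by (auto simp: column_def companion_A_def axis_def map_matrix_def mat_def)
  then show ?thesis by (simp add: vec_eq_iff)
qed

text \<open>The range of the input matrix contains the unit vectors of the last block. Applying the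
  companion matrix and removing the correction then reaches the earlier blocks one by one.\<close>

lemma companion_controllable:
  fixes V :: "(real^('p::{finite,linorder} \<times> 'k::finite)) set"
  assumes V: "subspace V" and B: "\<And>u. companion_B *v u \<in> V"
    and A: "\<And>v. v \<in> V \<Longrightarrow> companion_A A *v v \<in> V"
  shows "V = UNIV"
proof -
  \<comment> \<open>Here \<open>n\<close> is the distance of block \<open>i\<close> from the last
    block, so the induction runs backwards through the blocks.\<close>
  have "axis (i, a) 1 \<in> V" if "block_number i = CARD('p) - Suc n" "n < CARD('p)" for n i a
    using that
  proof (induction n arbitrary: i)
    case 0
    then show ?case using B[of "axis a 1"] by (simp add: companion_B_mult_axis)
  next
    case (Suc n)
    then have "CARD('p) - Suc n < CARD('p)" by simp
    then obtain j :: 'p where j: "block_number j = CARD('p) - Suc n" by (rule obtain_block_number)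
    with Suc.prems have "block_number j = Suc (block_number i)" by simp
    from companion_A_mult_axis_Suc[OF this, of A a]
    have "axis (i, a) 1 = companion_A A *v axis (j, a) 1
        + companion_B *v column a (A (CARD('p) - block_number j))" by simp
    also have "\<dots> \<in> V"
      using Suc.IH[OF j] Suc.prems by (intro subspace_add V A B) simp
    finally show ?case .
  qed
  note * = this
  have "axis (i, a) 1 \<in> V" for i a
    using *[of i "CARD('p) - Suc (block_number i)" a] block_number_less[of i] by simp
  then have "axis r 1 \<in> V" for r by (cases r) simp
  then have "(\<Sum>r\<in>UNIV. x $ r *\<^sub>R axis r 1) \<in> V" for x
    by (intro subspace_sum V subspace_scale)
  then have "x \<in> V" for x
    using basis_expansion[of x] by (metis scalar_mult_eq_scaleR)
  then show ?thesis by blast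
qed

text \<open>Such an \<open>S\<close> is a block Toeplitz matrix whose first block column is zero below the diagonal
  and whose last block column is that of the identity.\<close>

lemma companion_intertwiner_eq_id:
  fixes S :: "real^('p::{finite,linorder} \<times> 'k::finite)^('p \<times> 'k)"
  assumes A: "companion_A A' ** S = S ** companion_A A" and B: "S ** companion_B = companion_B"
  shows "S = mat 1"
proof -
  have SB: "S *v (companion_B *v u) = companion_B *v u" for u
    by (simp add: matrix_vector_mul_assoc B)
  have entry: "S $ r $ c = (S *v axis c 1) $ r" for r c
    by (simp add: matrix_vector_mult_basis column_def)
  have Brow: "(companion_B *v u :: real^('p \<times> 'k)) $ (i, a) = 0" if "block_number i \<noteq> CARD('p) - 1" for u i a
    using companion_B_mult[where 'a = real and u = u and i = i and a = a] that by (simp add: map_matrix_def)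
  \<comment> \<open>In row \<open>i\<close> of the intertwining relation, the left side is simply
    the next block row of \<open>S\<close>.\<close>
  have row: "S $ (i', a) $ c = (S *v (companion_A A *v axis c 1)) $ (i, a)"
    if "block_number i' = Suc (block_number i)" for i' i a c
    using companion_A_mult_shift[OF that, of A' "S *v axis c 1" a] A
    by (simp add: entry map_matrix_def matrix_vector_mul_assoc)
  have not_last: "block_number i \<noteq> CARD('p) - 1" if "block_number i' = Suc (block_number i)" for i' i :: 'p
    using block_number_less[of i'] that by simp
  have last: "S $ (i, a) $ (j, b) = (if (i, a) = (j, b) then 1 else 0)" if "block_number j = CARD('p) - 1" for i j a b
    unfolding entry companion_B_mult_axis[OF that, symmetric] SB
    unfolding companion_B_mult_axis[OF that] by (auto simp: axis_def)
  \<comment> \<open>The companion matrix sends unit vectors of block 0 into the range of the input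
    matrix. \<open>S\<close> fixes that range, whose elements vanish outside the last block; the
    same facts remove the correction term in \<open>shift\<close>.\<close>
  have first: "S $ (i', a) $ (j, b) = 0" if "block_number i' = Suc (block_number i)" "block_number j = 0" for i' i j :: 'p and a b
    unfolding row[OF that(1)] companion_A_mult_axis_0[OF that(2)]
    by (simp add: vec.neg SB Brow[OF not_last[OF that(1)]])
  have shift: "S $ (i', a) $ (j', b) = S $ (i, a) $ (j, b)"
    if "block_number i' = Suc (block_number i)" "block_number j' = Suc (block_number j)" for i i' j j' a b
    unfolding row[OF that(1)] companion_A_mult_axis_Suc[OF that(2)]
    by (simp add: matrix_vector_mult_diff_distrib SB Brow[OF not_last[OF that(1)]] entry)
  have "S $ (i, a) $ (j, b) = (if (i, a) = (j, b) then 1 else 0)" for i j a b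
  \<comment> \<open>On or above the diagonal, \<open>shift\<close> moves the entry along its
    diagonal to the last block column, settled by \<open>last\<close>; below it, the entry is moved
    back to the first block column, settled by \<open>first\<close>.\<close>
  proof (cases "block_number i \<le> block_number j")
    case True
    define n where "n = CARD('p) - Suc (block_number j)"
    then show ?thesis using True
    proof (induction n arbitrary: i j)
      case 0
      then show ?case using block_number_less[of j] by (intro last) simp
    next
      case (Suc n)
      then have "Suc (block_number i) < CARD('p)" "Suc (block_number j) < CARD('p)" by auto
      then obtain i' j' :: 'p where ij': "block_number i' = Suc (block_number i)" "block_number j' = Suc (block_number j)"
        by (elim obtain_block_number)
      then have "i' = j' \<longleftrightarrow> i = j" by (metis block_number_eq_iff nat.inject)
      with Suc.IH[of j' i'] Suc.prems ij' shift[OF ij'] show ?case by simp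
    qed
  next
    case False
    then have "S $ (i, a) $ (j, b) = 0"
    proof (induction "block_number j" arbitrary: i j)
      case 0
      then obtain i0 :: 'p where "block_number i = Suc (block_number i0)"
        by (metis obtain_block_number[of "block_number i - 1"] block_number_less less_imp_diff_less not_less_eq_eq
            Suc_pred' linorder_not_le)
      with first 0 show ?case by simp
    next
      case (Suc n)
      have lt: "block_number i - 1 < CARD('p)" "n < CARD('p)"
        using block_number_less[of i] block_number_less[of j] Suc.hyps(2) by auto
      obtain i0 :: 'p where i0: "block_number i0 = block_number i - 1" using lt(1) by (rule obtain_block_number)
      obtain j0 :: 'p where j0: "block_number j0 = n" using lt(2) by (rule obtain_block_number)
      have "block_number i = Suc (block_number i0)" "block_number j = Suc (block_number j0)"
        using i0 j0 Suc.prems Suc.hyps(2) by auto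
      from shift[OF this, of a b] Suc.hyps(1)[of j0 i0] show ?case
        using i0 j0 Suc.prems Suc.hyps(2) by auto
    qed
    with False show ?thesis by auto
  qed
  then show ?thesis by (simp add: vec_eq_iff mat_def)
qed


section \<open>From fraction descriptions to the companion model\<close>

lemma eventually_not_in_spectrum: "\<forall>\<^sub>F z in at_infinity. z \<notin> spectrum A"
  using resolvent_eventually_invertible[of "complex_matrix A"] by (simp add: not_in_spectrum_iff)

text \<open>Near infinity both spectra are avoided and both sides equal Q(z) P(z)^(-1), with P(z)
  invertible by the fraction description.\<close>

lemma coprime_rpfd_imp_companion_transfer_function:
  fixes \<A> :: "real^('p::{finite,linorder} \<times> 'k::finite)^('p \<times> 'k)" and A C :: "nat \<Rightarrow> real^'k^'k"
  assumes "q < CARD('p)"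
    and "coprime_rpfd_on (- spectrum \<A>) (transfer_function \<A> \<B> \<C>)
           (monic_matpoly CARD('p) A) (matpoly q C)"
  shows "\<forall>\<^sub>F z in at_infinity. transfer_function \<A> \<B> \<C> z
    = transfer_function (companion_A A :: real^('p \<times> 'k)^('p \<times> 'k)) companion_B (companion_C q C) z"
  using eventually_not_in_spectrum[of \<A>]
    eventually_not_in_spectrum[of "companion_A A :: real^('p \<times> 'k)^('p \<times> 'k)"]
proof eventually_elim
  case (elim z)
  with assms(2) show ?case
    by (simp add: companion_transfer_function[OF assms(1)] coprime_rpfd_on_def)
qed

lemma companion_isomorphism:
  fixes \<A> :: "real^('p::{finite,linorder} \<times> 'k::finite)^('p \<times> 'k)" and A C :: "nat \<Rightarrow> real^'k^'k"
  assumes "q < CARD('p)" and "right_coprime (monic_matpoly CARD('p) A) (matpoly q C)"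
    and "\<forall>\<^sub>F z in at_infinity. transfer_function \<A> \<B> \<C> z
      = transfer_function (companion_A A :: real^('p \<times> 'k)^('p \<times> 'k)) companion_B (companion_C q C) z"
  obtains S :: "real^('p \<times> 'k)^('p \<times> 'k)"
    where "invertible S" "\<A> ** S = S ** companion_A A" "S ** companion_B = \<B>"
    "\<C> ** S = companion_C q C"
proof (rule realization_isomorphism)
  show "\<C> *v (((*v) \<A> ^^ n) (\<B> *v u)) = (companion_C q C :: real^('p \<times> 'k)^'k) *v
      (((*v) (companion_A A) ^^ n) (companion_B *v u))" for n u
    by (rule transfer_function_eq_imp_markov_eq[OF assms(3)])
  show "V = UNIV" if "subspace V" "\<And>u. companion_B *v u \<in> V" "\<And>v. v \<in> V \<Longrightarrow> companion_A A *v v \<in> V"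
    for V :: "(real^('p \<times> 'k)) set"
    using that by (rule companion_controllable)
  show "y = 0" if "\<And>n. companion_C q C *v (((*v) (companion_A A) ^^ n) y) = 0" for y :: "real^('p \<times> 'k)"
    using assms(1,2) that by (rule companion_observable)
qed (rule that)

text \<open>The isomorphism between the two companion models is the identity, so their matrices
  coincide. The claim concerns polynomial functions, since \<open>A\<close> and \<open>A'\<close>
  may differ outside {1..p} and \<open>q\<close> may differ from \<open>q'\<close>.\<close>

lemma coprime_rpfd_unique:
  fixes \<A> :: "real^('p::{finite,linorder} \<times> 'k::finite)^('p \<times> 'k)" and A A' C C' :: "nat \<Rightarrow> real^'k^'k"
  assumes q: "q < CARD('p)" "q' < CARD('p)"
    and rpfd: "coprime_rpfd_on (- spectrum \<A>) (transfer_function \<A> \<B> \<C>)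
           (monic_matpoly CARD('p) A) (matpoly q C)"
    and rpfd': "coprime_rpfd_on (- spectrum \<A>) (transfer_function \<A> \<B> \<C>)
           (monic_matpoly CARD('p) A') (matpoly q' C')"
  shows "monic_matpoly CARD('p) A' = monic_matpoly CARD('p) A" and "matpoly q' C' = matpoly q C"
proof -
  let ?A = "companion_A A :: real^('p \<times> 'k)^('p \<times> 'k)" and ?A' = "companion_A A' :: real^('p \<times> 'k)^('p \<times> 'k)"
  let ?B = "companion_B :: real^'k^('p \<times> 'k)"
  let ?C = "companion_C q C :: real^('p \<times> 'k)^'k" and ?C' = "companion_C q' C' :: real^('p \<times> 'k)^'k"
  have eq: "\<forall>\<^sub>F z in at_infinity. transfer_function ?A' ?B ?C' z = transfer_function ?A ?B ?C z"
    using coprime_rpfd_imp_companion_transfer_function[OF q(1) rpfd]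
      coprime_rpfd_imp_companion_transfer_function[OF q(2) rpfd']
    by eventually_elim simp
  have coprime: "right_coprime (monic_matpoly CARD('p) A) (matpoly q C)"
    using rpfd by (simp add: coprime_rpfd_on_def)
  obtain S where S: "?A' ** S = S ** ?A" "S ** ?B = ?B" "?C' ** S = ?C"
    by (rule companion_isomorphism[OF q(1) coprime eq])
  from companion_intertwiner_eq_id[OF S(1,2)] S have A: "?A' = ?A" and C: "?C' = ?C" by auto
  \<comment> \<open>P is recovered from the companion matrix as B P(z) w = (z - A) applied to block
    powers; the last block then strips off B.\<close>
  have "complex_matrix ?B *v (monic_matpoly CARD('p) A' z *v w)
      = complex_matrix ?B *v (monic_matpoly CARD('p) A z *v w)" for z w
    using companion_A_block_powers[of A' z w, where 'p = 'p] companion_A_block_powers[of A z w, where 'p = 'p]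
    by (simp add: A)
  moreover obtain i :: 'p where "block_number i = CARD('p) - 1"
    by (rule obtain_last_block)
  ultimately have "(monic_matpoly CARD('p) A' z *v w) $ a = (monic_matpoly CARD('p) A z *v w) $ a" for z w a
    using companion_B_mult[of "monic_matpoly CARD('p) A z *v w" i a]
      companion_B_mult[of "monic_matpoly CARD('p) A' z *v w" i a] by simp
  then show "monic_matpoly CARD('p) A' = monic_matpoly CARD('p) A"
    by (simp add: fun_eq_iff matrix_eq vec_eq_iff)
  have "matpoly q' C' z *v w = matpoly q C z *v w" for z w
    using companion_C_block_powers[OF q(1), of C z w] companion_C_block_powers[OF q(2), of C' z w] C by simp
  then show "matpoly q' C' = matpoly q C"
    by (simp add: fun_eq_iff matrix_eq)
qed

theorem proposition2p9:
  fixes M :: "'w measure"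
    and L :: "real \<Rightarrow> 'w \<Rightarrow> real^'k"
    and \<A> :: "real^('p::{finite,linorder} \<times> 'k)^('p \<times> 'k)"
    and \<B> :: "real^'k^('p \<times> 'k)"
    and \<C> :: "real^('p \<times> 'k)^'k"
    and A C :: "nat \<Rightarrow> real^'k^'k"
    and q :: nat
  assumes "levy_process M L"
    and "q < CARD('p)"
    and "coprime_rpfd_on (- spectrum \<A>) (transfer_function \<A> \<B> \<C>)
           (monic_matpoly CARD('p) A) (matpoly q C)"
  shows
    "(\<forall>A' C' q'. q' < CARD('p) \<longrightarrow>
        coprime_rpfd_on (- spectrum \<A>) (transfer_function \<A> \<B> \<C>)
          (monic_matpoly CARD('p) A') (matpoly q' C') \<longrightarrow>
        monic_matpoly CARD('p) A' = monic_matpoly CARD('p) A \<and> matpoly q' C' = matpoly q C) \<and>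
     (let bA = companion_A A :: real^('p \<times> 'k)^('p \<times> 'k);
          bB = companion_B :: real^'k^('p \<times> 'k);
          bC = companion_C q C :: real^('p \<times> 'k)^'k
      in spectrum \<A> = spectrum bA \<and>
         (\<forall>z \<in> - spectrum bA. transfer_function \<A> \<B> \<C> z = transfer_function bA bB bC z) \<and>
         (\<forall>Y. ssm_solution M \<A> \<B> \<C> L Y \<longleftrightarrow> ssm_solution M bA bB bC L Y))"
proof -
  let ?A = "companion_A A :: real^('p \<times> 'k)^('p \<times> 'k)"
  let ?B = "companion_B :: real^'k^('p \<times> 'k)"
  let ?C = "companion_C q C :: real^('p \<times> 'k)^'k"
  have coprime: "right_coprime (monic_matpoly CARD('p) A) (matpoly q C)"
    using assms(3) by (simp add: coprime_rpfd_on_def)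
  obtain S where S: "invertible S" "\<A> ** S = S ** ?A" "S ** ?B = \<B>" "\<C> ** S = ?C"
    by (rule companion_isomorphism[OF assms(2) coprime
          coprime_rpfd_imp_companion_transfer_function[OF assms(2,3)]])
  \<comment> \<open>The transfer lemmas go one way only, so the inverse \<open>R\<close> is shown to
    intertwine the models in the opposite direction.\<close>
  from S(1) obtain R where R: "S ** R = mat 1" "R ** S = mat 1"
    by (auto simp: invertible_def)
  have "?A ** R = R ** (S ** ?A) ** R" by (simp add: R matrix_mul_assoc)
  also have "\<dots> = R ** \<A> ** (S ** R)" by (simp only: S(2)[symmetric] matrix_mul_assoc)
  finally have RA: "?A ** R = R ** \<A>" by (simp add: R)
  have RB: "R ** \<B> = ?B" unfolding S(3)[symmetric] by (simp add: matrix_mul_assoc R)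
  have RC: "?C ** R = \<C>" unfolding S(4)[symmetric] by (simp add: R flip: matrix_mul_assoc)
  have "invertible R" using R by (auto simp: invertible_def)
  then have spectrum: "spectrum \<A> = spectrum ?A"
    using spectrum_subset_if_intertwined S(1,2) RA by blast
  moreover have "transfer_function \<A> \<B> \<C> z = transfer_function ?A ?B ?C z" if "z \<in> - spectrum ?A" for z
    using transfer_function_intertwine[OF S(2-4)] that spectrum by simp
  moreover have "ssm_solution M \<A> \<B> \<C> L Y \<longleftrightarrow> ssm_solution M ?A ?B ?C L Y" for Y
    using ssm_solution_intertwine[OF assms(1) RA RB RC] ssm_solution_intertwine[OF assms(1) S(2-4)] by blast
  moreover have "monic_matpoly CARD('p) A' = monic_matpoly CARD('p) A" "matpoly q' C' = matpoly q C"
    if "q' < CARD('p)" "coprime_rpfd_on (- spectrum \<A>) (transfer_function \<A> \<B> \<C>)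
          (monic_matpoly CARD('p) A') (matpoly q' C')" for A' C' q'
    using coprime_rpfd_unique[OF assms(2) that(1) assms(3) that(2)] by auto
  ultimately show ?thesis by (simp add: Let_def)
qed

end
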